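(* Let $p$ be a prime and let $n$ be even. 1. Let $F\colon\mathbb{F}_{p^{n/2}}\times\mathbb{F}_{p^{n/2}}\to\mathbb{F}_p^m$ be a Maiorana–McFarland bent function defined by $F(x,y)=L(x\pi(y))+\rho(y)$, where $\pi\colon\mathbb{F}_{p^{n/2}}\to\mathbb{F}_{p^{n/2}}$ is a permutation, $\rho\colon\mathbb{F}_{p^{n/2}}\to\mathbb{F}_p^m$ is an arbitrary function, and $L\colon\mathbb{F}_{p^{n/2}}\to\mathbb{F}_p^m$ is a surjective linear mapping. Let $\pi(y^* )=0$ and $\alpha:=\rho(y^* )$ for $y^*\in\mathbb{F}_{p^{n/2}}$. Then $|F^{-1}(\alpha)|=p^{n-m}+p^{n/2}-p^{n/2-m}$ and $|F^{-1}(\beta)|=p^{n-m}-p^{n/2-m}$ for each $\beta\ne\alpha$, and hence $F$ is almost balanced of type $(+)$. 2. Let $F\colon\mathbb{F}_{p^{n/2}}\times\mathbb{F}_{p^{n/2}}\to\mathbb{F}_p^m$ be a Desarguesian partial spread bent function defined by $F(x,y)=\Psi(xy^{p^{n/2}-2})$, where $\Psi\colon\mathbb{F}_{p^{n/2}}\to\mathbb{F}_p^m$ is an arbitrary balanced function. Then $|F^{-1}(0)|=p^{n-m}+p^{n/2}-p^{n/2-m}$ and $|F^{-1}(\beta)|=p^{n-m}-p^{n/2-m}$ for each $\beta\neq 0$, and hence $F$ is almost balanced of type $(+)$.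
   Context: A function $F\colon\mathbb{F}_p^n\to\mathbb{F}_p^m$ is bent (perfect nonlinear) if $|\{x: F(x+a)-F(x)=b\}|=p^{n-m}$ for all nonzero $a\in\mathbb{F}_p^n$ and all $b\in\mathbb{F}_p^m$; here $\mathbb{F}_{p^{n/2}}\times\mathbb{F}_{p^{n/2}}$ is identified with $\mathbb{F}_p^n$ as an $\mathbb{F}_p$-vector space. A bent function $F\colon\mathbb{F}_p^n\to\mathbb{F}_p^m$ is almost balanced of type $(+)$ if there is $\alpha$ with $|F^{-1}(\alpha)|=p^{n-m}+p^{n/2}-p^{n/2-m}$ and $|F^{-1}(\beta)|=p^{n-m}-p^{n/2-m}$ for all $\beta\ne\alpha$. A function $\Psi\colon\mathbb{F}_{p^{n/2}}\to\mathbb{F}_p^m$ is balanced if all its preimage sets have size $p^{n/2-m}$. The expression $y^{p^{n/2}-2}$ stands for $y^{-1}$ with the convention $0^{-1}=0$.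
   Formalization: In part 2 the exceptional value is Ψ(0) instead of 0: for an arbitrary balanced Ψ the printed claim fails when Ψ(0) ≠ 0 (e.g. p=3, n=2, m=1, Ψ(x)=x+1), and it is recovered verbatim when Ψ(0)=0. *)

theory Defs
  imports
    "HOL-Analysis.Analysis"
    "Berlekamp_Zassenhaus.Finite_Field"
begin

text \<open>
  The prime field with \<open>p = CARD('p)\<close> elements is \<open>'p mod_ring\<close>, and its \<open>m\<close>-dimensional
  coordinate space is \<open>'p mod_ring ^ 'm\<close> with \<open>m = CARD('m)\<close>, so \<open>m \<ge> 1\<close>.
  Exponents such as \<open>n - m\<close> are integers and the powers are real, which avoids truncated
  subtraction on \<^typ>\<open>nat\<close>.
\<close>

text \<open>
  Scalar multiplication of the prime field on a finite field of characteristic \<open>CARD('p)\<close>.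
  The scalar acts through its representative in \<open>{0..<CARD('p)}\<close>; lemma
  \<open>vector_space_fp_scale\<close> below shows that this is well behaved.
\<close>

definition fp_scale :: "'p::prime_card mod_ring \<Rightarrow> 'k::field \<Rightarrow> 'k" where
  "fp_scale c x = of_int (to_int_mod_ring c) * x"

text \<open>
  Only the additive group of the domain enters, so no basis has to be chosen to
  identify the domain with the coordinate space of dimension \<open>n\<close>.
\<close>

definition bent :: "nat \<Rightarrow> nat \<Rightarrow> nat \<Rightarrow> ('a::ab_group_add \<Rightarrow> 'b::ab_group_add) \<Rightarrow> bool" where
  "bent p n m F \<longleftrightarrow>
     (\<forall>a b. a \<noteq> 0 \<longrightarrow>
        real (card {x. F (x + a) - F x = b}) = real p powi (int n - int m))"

definition almost_balanced_plus ::
    "nat \<Rightarrow> nat \<Rightarrow> nat \<Rightarrow> ('a::ab_group_add \<Rightarrow> 'b::ab_group_add) \<Rightarrow> bool" where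
  "almost_balanced_plus p n m F \<longleftrightarrow>
     bent p n m F \<and>
     (\<exists>\<alpha>. real (card (F -` {\<alpha>})) =
            real p powi (int n - int m) + real p powi int (n div 2)
              - real p powi (int (n div 2) - int m) \<and>
          (\<forall>\<beta>. \<beta> \<noteq> \<alpha> \<longrightarrow>
            real (card (F -` {\<beta>})) =
              real p powi (int n - int m) - real p powi (int (n div 2) - int m)))"

text \<open>Here \<open>r\<close> is the dimension of the domain over the prime field.\<close>

definition balanced :: "nat \<Rightarrow> nat \<Rightarrow> nat \<Rightarrow> ('a \<Rightarrow> 'b) \<Rightarrow> bool" where
  "balanced p r m \<Psi> \<longleftrightarrow>
     (\<forall>b. real (card (\<Psi> -` {b})) = real p powi (int r - int m))"

definition maiorana_mcfarland ::
    "('k::field \<Rightarrow> 'b::ab_group_add) \<Rightarrow> ('k \<Rightarrow> 'k) \<Rightarrow> ('k \<Rightarrow> 'b) \<Rightarrow> 'k \<times> 'k \<Rightarrow> 'b" where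
  "maiorana_mcfarland L \<pi> \<rho> = (\<lambda>(x, y). L (x * \<pi> y) + \<rho> y)"

text \<open>
  The library convention \<open>inverse 0 = 0\<close> is the one wanted here. In a field with \<open>q > 2\<close>
  elements \<open>inverse y = y ^ (q - 2)\<close>; for \<open>q = 2\<close> the power would be \<open>0 ^ 0 = 1\<close> at \<open>0\<close>.
  The function takes the value \<open>\<Psi> 0\<close> on both coordinate axes, which makes \<open>\<Psi> 0\<close> the
  exceptional value (it is \<open>0\<close> under the usual normalisation \<open>\<Psi> 0 = 0\<close>).
\<close>

definition desarguesian_ps :: "('k::field \<Rightarrow> 'b) \<Rightarrow> 'k \<times> 'k \<Rightarrow> 'b" where
  "desarguesian_ps \<Psi> = (\<lambda>(x, y). \<Psi> (x * inverse y))"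

lemma of_nat_card_eq_0_if_card_eq_power:
  assumes "CARD('k::{field,finite}) = q ^ r"
  shows "(of_nat q :: 'k) = 0"
proof -
  have "(\<Sum>x\<in>(UNIV::'k set). x) = (\<Sum>x\<in>(UNIV::'k set). x + 1)"
    by (rule sum.reindex_bij_witness[of _ "\<lambda>x. x + 1" "\<lambda>x. x - 1"]) auto
  also have "\<dots> = (\<Sum>x\<in>(UNIV::'k set). x) + of_nat CARD('k)"
    by (simp add: sum.distrib)
  finally have "(of_nat (q ^ r) :: 'k) = 0"
    using assms by simp
  then show ?thesis
    by simp
qed

lemma vector_space_fp_scale:
  assumes "CARD('k::{field,finite}) = CARD('p::prime_card) ^ r"
  shows "vector_space (fp_scale :: 'p mod_ring \<Rightarrow> 'k \<Rightarrow> 'k)"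
proof -
  have 0: "(of_int (int CARD('p)) :: 'k) = 0"
    using of_nat_card_eq_0_if_card_eq_power[OF assms] by simp
  have red: "(of_int (z mod int CARD('p)) :: 'k) = of_int z" for z
  proof -
    have "(of_int z :: 'k) = of_int (z div int CARD('p) * int CARD('p) + z mod int CARD('p))"
      by simp
    also have "\<dots> = of_int (z mod int CARD('p))"
      using 0 by (simp only: of_int_add of_int_mult) simp
    finally show ?thesis ..
  qed
  have add: "(of_int (to_int_mod_ring (a + b)) :: 'k) =
      of_int (to_int_mod_ring a) + of_int (to_int_mod_ring b)" for a b :: "'p mod_ring"
    by (simp only: to_int_mod_ring.rep_eq plus_mod_ring.rep_eq red of_int_add)
  have mult: "(of_int (to_int_mod_ring (a * b)) :: 'k) =
      of_int (to_int_mod_ring a) * of_int (to_int_mod_ring b)" for a b :: "'p mod_ring"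
    by (simp only: to_int_mod_ring.rep_eq times_mod_ring.rep_eq red of_int_mult)
  show ?thesis
    by unfold_locales (simp_all add: fp_scale_def add mult algebra_simps)
qed

end

theory Submission
  imports Defs
begin

text \<open>
  For Maiorana--McFarland functions everything is counted fibrewise in \<open>y\<close>, because a
  surjective additive map composed with a nonconstant affine map is balanced.
  A Desarguesian partial spread function is constant, off the origin, on the members of the
  spread of all lines through the origin of the plane; the line \<open>y = 0\<close> takes the same value as
  the line \<open>x = 0\<close>, so among the \<open>q + 1\<close> lines exactly one value is taken once more often than
  the others. Translated members of a spread meet in one point unless they are parallel, and
  summing this over all pairs of lines with prescribed difference of values gives bentness.
\<close>

section \<open>Cardinalities as sums of indicators and as sums over fibres\<close>

lemma of_bool_sum_eq_card: "(\<Sum>x\<in>(UNIV::'a::finite set). of_bool (P x) :: real) = card {x. P x}"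
  by simp

lemma sum_mult_of_bool_eq:
  fixes f :: "'a::finite \<Rightarrow> real"
  shows "(\<Sum>x\<in>UNIV. f x * of_bool (x = a)) = f a"
proof -
  have "f x * of_bool (x = a) = (if x = a then f x else 0)" for x
    by simp
  then show ?thesis by (simp only: sum.delta finite UNIV_I if_True)
qed

lemma card_fibrewise:
  "card {(x :: 'a::finite, y :: 'b::finite). P x y} = (\<Sum>y\<in>UNIV. card {x. P x y})"
proof -
  have "{(x, y). P x y} = (\<lambda>(y, x). (x, y)) ` (SIGMA y:UNIV. {x. P x y})"
    by auto
  moreover have "inj (\<lambda>(y :: 'b, x :: 'a). (x, y))"
    by (auto intro: injI)
  ultimately show ?thesis
    by (simp add: card_image inj_on_subset[OF _ subset_UNIV])
qed

section \<open>Spreads of finite abelian groups and functions labelled by them\<close>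

text \<open>The shift \<open>d\<close> lets \<open>transversal\<close> express two things at once:
  distinct members intersect trivially (the case \<open>d = 0\<close>), and together they generate
  the group.\<close>

locale spread =
  fixes l :: "'s::finite \<Rightarrow> 'a::{ab_group_add,finite} set" and q :: nat
  assumes zero: "0 \<in> l s"
    and diff: "z \<in> l s \<Longrightarrow> w \<in> l s \<Longrightarrow> z - w \<in> l s"
    and card_l: "card (l s) = q"
    and card_index: "CARD('s) = q + 1"
    and cover: "\<exists>s. z \<in> l s"
    and transversal: "s \<noteq> t \<Longrightarrow> \<exists>!z. z \<in> l s \<and> z + d \<in> l t"
begin

lemma unique: "z \<noteq> 0 \<Longrightarrow> z \<in> l s \<Longrightarrow> z \<in> l t \<Longrightarrow> s = t"
  using transversal[of s t 0] zero by fastforce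

lemma in_l_iff: "z \<noteq> 0 \<Longrightarrow> z \<in> l s \<Longrightarrow> z \<in> l t \<longleftrightarrow> t = s"
  using unique by blast

text \<open>Members are subgroups, so a translate of \<open>l s\<close> is either \<open>l s\<close>
  itself or disjoint from it; distinct members are settled by \<open>transversal\<close>. The
  indicator form can be summed over all pairs \<open>s\<close>, \<open>t\<close>.\<close>

lemma card_meet:
  "real (card {z. z \<in> l s \<and> z + d \<in> l t}) =
     1 - of_bool (s = t) + real q * of_bool (s = t \<and> d \<in> l s)"
proof (cases "s = t")
  case False
  then obtain z where "{z. z \<in> l s \<and> z + d \<in> l t} = {z}"
    using transversal[of s t d] by (auto simp: set_eq_iff)
  then show ?thesis using False by simp
next
  case True
  have "z + d \<in> l s \<longleftrightarrow> d \<in> l s" if "z \<in> l s" for z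
  proof
    assume "z + d \<in> l s"
    from diff[OF this that] show "d \<in> l s" by simp
  next
    assume d: "d \<in> l s"
    from diff[OF d diff[OF zero that]] show "z + d \<in> l s" by (simp add: add.commute)
  qed
  then have "{z. z \<in> l s \<and> z + d \<in> l t} = (if d \<in> l s then l s else {})"
    using True by auto
  then show ?thesis using True card_l by auto
qed

text \<open>Summing \<open>card_\<Psi>\<close> over all \<open>b\<close> shows that \<open>q\<close>
  is \<open>M\<close> times the order of \<open>'b\<close>; the surplus label \<open>F 0\<close>
  accounts for the one further member.\<close>

context
  fixes F :: "'a \<Rightarrow> 'b::{ab_group_add,finite}" and \<Psi> :: "'s \<Rightarrow> 'b" and M :: real
  assumes F: "z \<noteq> 0 \<Longrightarrow> z \<in> l s \<Longrightarrow> F z = \<Psi> s"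
    and card_\<Psi>: "real (card (\<Psi> -` {b})) = M + of_bool (b = F 0)"
begin

lemma sum_\<Psi>: "(\<Sum>s\<in>UNIV. of_bool (\<Psi> s = b)) = M + of_bool (b = F 0)"
  using card_\<Psi>[of b] by (simp add: vimage_def)

text \<open>A nonzero point lies on exactly one member, so incidences are counted twice:
  \<open>q\<close> points for each member labelled \<open>b\<close>. The origin lies on all
  \<open>M + of_bool (b = F 0)\<close> such members, hence is counted \<open>M\<close> times too
  often.\<close>

lemma card_vimage: "real (card (F -` {b})) = q * M - M + real q * of_bool (b = F 0)"
proof -
  have "of_bool (F z = b) = (\<Sum>s\<in>UNIV. of_bool (\<Psi> s = b) * of_bool (z \<in> l s)) - M * of_bool (z = 0)"
    for z
  proof (cases "z = 0")
    case True
    then show ?thesis using sum_\<Psi>[of b] by (auto simp: zero)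
  next
    case False
    obtain s where s: "z \<in> l s" using cover by blast
    have "(\<Sum>t\<in>UNIV. of_bool (\<Psi> t = b) * of_bool (z \<in> l t)) = (of_bool (\<Psi> s = b) :: real)"
      by (simp only: in_l_iff[OF False s] sum_mult_of_bool_eq)
    then show ?thesis using False F[OF False s] by simp
  qed
  moreover have "real (card (F -` {b})) = (\<Sum>z\<in>UNIV. of_bool (F z = b))"
    by (simp add: vimage_def)
  ultimately have "real (card (F -` {b})) =
      (\<Sum>z\<in>UNIV. (\<Sum>s\<in>UNIV. of_bool (\<Psi> s = b) * of_bool (z \<in> l s)) - M * of_bool (z = 0))"
    by simp
  also have "\<dots> = (\<Sum>z\<in>UNIV. \<Sum>s\<in>UNIV. of_bool (\<Psi> s = b) * of_bool (z \<in> l s)) - M"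
    by (simp only: sum_subtractf sum_mult_of_bool_eq)
  also have "\<dots> = (\<Sum>s\<in>UNIV. of_bool (\<Psi> s = b) * (\<Sum>z\<in>UNIV. of_bool (z \<in> l s))) - M"
    by (subst sum.swap) (simp only: sum_distrib_left)
  also have "\<dots> = (M + of_bool (b = F 0)) * q - M"
  proof -
    have "(\<Sum>z\<in>UNIV. of_bool (z \<in> l s)) = real q" for s
      by (simp add: card_l)
    then show ?thesis
      by (simp only: sum_\<Psi> flip: sum_distrib_right)
  qed
  finally show ?thesis by (simp add: algebra_simps)
qed

text \<open>Points \<open>z\<close> are sorted by the pair of members containing \<open>z\<close>
  and \<open>z + d\<close>, weighted by whether the labels differ by \<open>c\<close>;
  \<open>card_meet\<close> then counts the points belonging to each pair.\<close>

lemma card_derivative: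
  assumes d: "d \<noteq> 0"
  shows "real (card {z. F (z + d) - F z = c}) = q * M"
proof -
  define P :: "'s \<Rightarrow> 's \<Rightarrow> real" where "P s t = of_bool (\<Psi> t - \<Psi> s = c)" for s t
  have P1: "(\<Sum>s\<in>UNIV. P s t) = M + of_bool (\<Psi> t - F 0 = c)" for t
  proof -
    have "(\<Psi> t - \<Psi> s = c) = (\<Psi> s = \<Psi> t - c)" "(\<Psi> t - F 0 = c) = (\<Psi> t - c = F 0)" for s
      by (auto simp: algebra_simps)
    then show ?thesis unfolding P_def by (simp only: sum_\<Psi>)
  qed
  have P2: "(\<Sum>t\<in>UNIV. P s t) = M + of_bool (F 0 - \<Psi> s = c)" for s
  proof -
    have "(\<Psi> t - \<Psi> s = c) = (\<Psi> t = \<Psi> s + c)" "(F 0 - \<Psi> s = c) = (\<Psi> s + c = F 0)" for t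
      by (auto simp: algebra_simps)
    then show ?thesis unfolding P_def by (simp only: sum_\<Psi>)
  qed
  have P3: "(\<Sum>s\<in>UNIV. P s s) = (real q + 1) * of_bool (c = 0)"
    by (auto simp: P_def card_index)
  \<comment> \<open>Every row sum contributes \<open>M\<close>; the surplus comes from the rows
    labelled \<open>F 0 - c\<close>, of which there are \<open>M + of_bool (c = 0)\<close>.\<close>
  have P4: "(\<Sum>s\<in>UNIV. \<Sum>t\<in>UNIV. P s t) = (real q + 2) * M + of_bool (c = 0)"
  proof -
    have "(F 0 - \<Psi> s = c) = (\<Psi> s = F 0 - c)" for s
      by (auto simp: algebra_simps)
    then have "(\<Sum>s\<in>UNIV. \<Sum>t\<in>UNIV. P s t) = (real q + 1) * M + (M + of_bool (F 0 - c = F 0))"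
      by (simp only: P2 sum.distrib sum_\<Psi>) (simp add: card_index)
    then show ?thesis by (simp add: algebra_simps)
  qed
  have collapse: "(\<Sum>s\<in>UNIV. f s * of_bool (z \<in> l s)) = f s" if "z \<noteq> 0" "z \<in> l s"
    for f :: "'s \<Rightarrow> real" and z s
    by (simp only: in_l_iff[OF that] sum_mult_of_bool_eq)
  \<comment> \<open>One member serves both exceptional points: \<open>z + d = d\<close> when
    \<open>z = 0\<close>, and \<open>z = - d\<close>.\<close>
  obtain r where r: "d \<in> l r" using cover by blast
  have r': "- d \<in> l r" using diff[OF zero r] by simp
  let ?Q = "\<lambda>z. \<Sum>s\<in>UNIV. (\<Sum>t\<in>UNIV. P s t * of_bool (z + d \<in> l t)) * of_bool (z \<in> l s)"
  \<comment> \<open>At \<open>z = 0\<close> and \<open>z = - d\<close> one of the two points is the origin, which lies on every member of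
    the spread, so \<open>?Q\<close> exceeds the indicator by \<open>M\<close> there.\<close>
  have "of_bool (F (z + d) - F z = c) = ?Q z - M * of_bool (z = 0) - M * of_bool (z = - d)" for z
  proof -
    consider "z = 0" | "z = - d" | "z \<noteq> 0" "z + d \<noteq> 0"
      by (metis add.inverse_inverse add_eq_0_iff2 neg_eq_iff_add_eq_0)
    then show ?thesis
    proof cases
      case 1
      \<comment> \<open>All \<open>s\<close> occur but only \<open>t = r\<close> survives, which
        leaves a column sum of \<open>P\<close>; the case \<open>z = - d\<close> leaves a row sum in
        the same way.\<close>
      then show ?thesis using d collapse[OF d r] F[OF d r] P1[of r] by (auto simp: zero)
    next
      case 2
      have d': "- d \<noteq> 0" using d by simp
      show ?thesis using 2 d collapse[OF d' r'] F[OF d' r'] P2[of r] by (auto simp: zero)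
    next
      case 3
      obtain s t where s: "z \<in> l s" and t: "z + d \<in> l t" using cover by metis
      have "?Q z = P s t"
        by (simp only: collapse[OF 3(1) s] collapse[OF 3(2) t])
      moreover have "z \<noteq> - d" using 3 by auto
      ultimately show ?thesis
        using 3 F[OF 3(1) s] F[OF 3(2) t] by (simp add: P_def)
    qed
  qed
  then have "(\<Sum>z\<in>UNIV. of_bool (F (z + d) - F z = c)) =
      (\<Sum>z\<in>UNIV. ?Q z - M * of_bool (z = 0) - M * of_bool (z = - d))"
    by (simp only:)
  then have "real (card {z. F (z + d) - F z = c}) = (\<Sum>z\<in>UNIV. ?Q z) - M - M"
    by (simp only: of_bool_sum_eq_card sum_subtractf sum_mult_of_bool_eq)
  also have "(\<Sum>z\<in>UNIV. ?Q z) =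
      (\<Sum>z\<in>UNIV. \<Sum>s\<in>UNIV. \<Sum>t\<in>UNIV. P s t * of_bool (z \<in> l s \<and> z + d \<in> l t))"
    unfolding sum_distrib_right by (intro sum.cong refl) auto
  also have "\<dots> = (\<Sum>s\<in>UNIV. \<Sum>z\<in>UNIV. \<Sum>t\<in>UNIV. P s t * of_bool (z \<in> l s \<and> z + d \<in> l t))"
    by (rule sum.swap)
  also have "\<dots> = (\<Sum>s\<in>UNIV. \<Sum>t\<in>UNIV. \<Sum>z\<in>UNIV. P s t * of_bool (z \<in> l s \<and> z + d \<in> l t))"
    by (intro sum.cong refl sum.swap)
  also have "\<dots> = (\<Sum>s\<in>UNIV. \<Sum>t\<in>UNIV. P s t * card {z. z \<in> l s \<and> z + d \<in> l t})"
    by (simp only: of_bool_sum_eq_card flip: sum_distrib_left)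
  \<comment> \<open>A pair of equal members contributes only if it contains \<open>d\<close>, that
    is for \<open>s = r\<close>.\<close>
  also have "\<dots> = (\<Sum>s\<in>UNIV. \<Sum>t\<in>UNIV. P s t - P s t * of_bool (t = s)
      + q * P s t * of_bool (s = r) * of_bool (t = s))"
    unfolding card_meet in_l_iff[OF d r] by (intro sum.cong refl) (auto simp: algebra_simps)
  also have "\<dots> = (\<Sum>s\<in>UNIV. \<Sum>t\<in>UNIV. P s t) - (\<Sum>s\<in>UNIV. P s s) + q * P r r"
    by (simp only: sum.distrib sum_subtractf sum_mult_of_bool_eq)
  \<comment> \<open>Equal members have label difference 0, so the coefficients of
    \<open>of_bool (c = 0)\<close> cancel: \<open>1 - (q + 1) + q = 0\<close>. Removing the two
    surplus copies of \<open>M\<close> then leaves \<open>q * M\<close>.\<close>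
  also have "\<dots> = (real q + 2) * M"
    unfolding P3 P4 by (auto simp: P_def algebra_simps)
  finally show ?thesis by (simp add: algebra_simps)
qed

end

end

section \<open>The Desarguesian spread of the plane\<close>

text \<open>The index is the ratio \<open>x / y\<close>, the very argument passed to
  \<open>\<Psi>\<close>; \<open>None\<close> stands for the infinite ratio.\<close>

fun plane_line :: "'k::field option \<Rightarrow> ('k \<times> 'k) set" where
  "plane_line None = {(x, y). y = 0}"
| "plane_line (Some s) = {(x, y). x = s * y}"

lemma spread_plane_line: "spread (plane_line :: 'k::{field,finite} option \<Rightarrow> _) CARD('k)"
proof
  fix s t :: "'k option" and z w d :: "'k \<times> 'k"
  show "0 \<in> plane_line s"
    by (cases s) (auto simp: zero_prod_def)
  show "z - w \<in> plane_line s" if "z \<in> plane_line s" "w \<in> plane_line s"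
    using that by (cases s) (auto simp: algebra_simps)
  show "card (plane_line s) = CARD('k)"
  proof (cases s)
    case None
    have "plane_line s = (\<lambda>x. (x, 0)) ` UNIV" using None by auto
    then show ?thesis by (simp add: card_image inj_on_def)
  next
    case (Some a)
    have "plane_line s = (\<lambda>y. (a * y, y)) ` UNIV" using Some by auto
    then show ?thesis by (simp add: card_image inj_on_def)
  qed
  show "CARD('k option) = CARD('k) + 1"
    by simp
  show "\<exists>s. z \<in> plane_line s"
  proof (cases "snd z = 0")
    case True
    then have "z \<in> plane_line None" by auto
    then show ?thesis ..
  next
    case False
    then have "z \<in> plane_line (Some (fst z / snd z))" by (cases z) auto
    then show ?thesis ..
  qed
  show "\<exists>!z. z \<in> plane_line s \<and> z + d \<in> plane_line t" if st: "s \<noteq> t"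
  proof -
    obtain a b where d: "d = (a, b)" by (cases d)
    show ?thesis
    proof (cases s)
      case None
      then obtain v where "t = Some v" using st by (cases t) auto
      with None show ?thesis
        \<comment> \<open>The translated point has second coordinate \<open>b\<close>, so its first
          coordinate must be \<open>v * b\<close>.\<close>
        by (intro ex1I[of _ "(v * b - a, 0)"]) (auto simp: d eq_diff_eq)
    next
      case (Some u)
      show ?thesis
      proof (cases t)
        case None
        with Some show ?thesis
          by (intro ex1I[of _ "(u * - b, - b)"]) (auto simp: d add_eq_0_iff2)
      next
        case (Some v)
        with \<open>s = Some u\<close> st have uv: "u - v \<noteq> 0" by auto
        \<comment> \<open>The second coordinate of the common point solves a linear equation with
          leading coefficient \<open>u - v\<close>.\<close>
        define c where "c = (v * b - a) / (u - v)"
        have "u * y + a = v * (y + b) \<longleftrightarrow> y * (u - v) = v * b - a" for y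
          by (auto simp: algebra_simps)
        then have y_eq: "u * y + a = v * (y + b) \<longleftrightarrow> y = c" for y
          unfolding c_def nonzero_eq_divide_eq[OF uv] .
        have "z \<in> plane_line s \<and> z + d \<in> plane_line t \<longleftrightarrow> fst z = u * snd z \<and> snd z = c" for z
          unfolding Some \<open>s = Some u\<close> d
          by (cases z) (simp add: y_eq cong: conj_cong)
        then show ?thesis
          by (intro ex1I[of _ "(u * c, c)"]) (simp_all add: prod_eq_iff)
      qed
    qed
  qed
qed

text \<open>By \<open>inverse 0 = 0\<close> the line \<open>None\<close> repeats the label of
  \<open>Some 0\<close>, which makes \<open>\<Psi> 0\<close> the label with one surplus
  occurrence.\<close>

definition plane_label :: "('k::field \<Rightarrow> 'b) \<Rightarrow> 'k option \<Rightarrow> 'b" where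
  "plane_label \<Psi> s = \<Psi> (case s of None \<Rightarrow> 0 | Some v \<Rightarrow> v)"

lemma desarguesian_ps_on_plane_line:
  "z \<noteq> 0 \<Longrightarrow> z \<in> plane_line s \<Longrightarrow> desarguesian_ps \<Psi> z = plane_label \<Psi> s"
  by (cases s; cases z) (auto simp: mult.assoc desarguesian_ps_def plane_label_def zero_prod_def)

lemma card_vimage_plane_label:
  fixes \<Psi> :: "'k::{field,finite} \<Rightarrow> 'b"
  shows "card (plane_label \<Psi> -` {b}) = card (\<Psi> -` {b}) + of_bool (b = \<Psi> 0)"
proof -
  have "plane_label \<Psi> -` {b} = Some ` (\<Psi> -` {b}) \<union> (if b = \<Psi> 0 then {None} else {})"
    by (auto simp: plane_label_def split: option.splits)
  then show ?thesis by (auto simp: card_image)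
qed

lemma desarguesian_ps_counts:
  fixes \<Psi> :: "'k::{field,finite} \<Rightarrow> 'b::{ab_group_add,finite}"
  assumes "\<And>b. real (card (\<Psi> -` {b})) = M"
  shows "real (card (desarguesian_ps \<Psi> -` {b})) =
           real CARD('k) * M - M + real CARD('k) * of_bool (b = \<Psi> 0)"
    and "d \<noteq> 0 \<Longrightarrow>
           real (card {z. desarguesian_ps \<Psi> (z + d) - desarguesian_ps \<Psi> z = c}) = real CARD('k) * M"
proof -
  interpret spread "plane_line :: 'k option \<Rightarrow> _" "CARD('k)"
    by (rule spread_plane_line)
  have F0: "desarguesian_ps \<Psi> 0 = \<Psi> 0"
    by (simp add: desarguesian_ps_def zero_prod_def)
  \<comment> \<open>The lines \<open>Some v\<close> carry each label \<open>M\<close> times;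
    \<open>None\<close> supplies the surplus.\<close>
  have lab: "real (card (plane_label \<Psi> -` {b})) = M + of_bool (b = desarguesian_ps \<Psi> 0)" for b
    by (simp add: card_vimage_plane_label assms F0)
  show "real (card (desarguesian_ps \<Psi> -` {b})) =
           real CARD('k) * M - M + real CARD('k) * of_bool (b = \<Psi> 0)"
    using card_vimage[where F = "desarguesian_ps \<Psi>" and \<Psi> = "plane_label \<Psi>", OF desarguesian_ps_on_plane_line lab] by (simp add: F0)
  show "real (card {z. desarguesian_ps \<Psi> (z + d) - desarguesian_ps \<Psi> z = c}) = real CARD('k) * M"
    if "d \<noteq> 0"
    using card_derivative[where F = "desarguesian_ps \<Psi>" and \<Psi> = "plane_label \<Psi>", OF desarguesian_ps_on_plane_line lab that] .
qed

section \<open>Additive maps and Maiorana--McFarland functions\<close>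

text \<open>The fibres are cosets of the kernel, so translation by a preimage of
  \<open>b - c\<close> carries the fibre over \<open>c\<close> onto the fibre over
  \<open>b\<close>.\<close>

lemma card_vimage_additive:
  fixes L :: "'a::{ab_group_add,finite} \<Rightarrow> 'b::{ab_group_add,finite}"
  assumes add: "\<And>x y. L (x + y) = L x + L y" and "surj L"
  shows "card (L -` {b}) * CARD('b) = CARD('a)"
proof -
  have eq: "card (L -` {c}) = card (L -` {b})" for c
  proof -
    obtain w where w: "L w = b - c" using \<open>surj L\<close> by (metis surjD)
    have "bij_betw (\<lambda>x. x + w) (L -` {c}) (L -` {b})"
    proof (rule bij_betwI[of _ _ _ "\<lambda>x. x - w"])
      show "(\<lambda>x. x - w) \<in> L -` {b} \<rightarrow> L -` {c}"
      proof
        fix x assume "x \<in> L -` {b}"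
        then show "x - w \<in> L -` {c}" using add[of "x - w" w] w by simp
      qed
    qed (auto simp: add w)
    then show ?thesis by (rule bij_betw_same_card)
  qed
  have "CARD('a) = card (\<Union>c\<in>UNIV. L -` {c})"
    by (rule arg_cong[of _ _ card]) auto
  also have "\<dots> = (\<Sum>c\<in>UNIV. card (L -` {c}))"
    by (rule card_UN_disjoint) auto
  also have "\<dots> = card (L -` {b}) * CARD('b)"
    by (subst sum.cong[OF refl eq]) simp
  finally show ?thesis ..
qed

lemma card_vimage_affine:
  fixes u w :: "'k::{field,finite}"
  assumes "u \<noteq> 0"
  shows "card {x. f (x * u + w) = b} = card (f -` {b})"
proof (rule bij_betw_same_card)
  show "bij_betw (\<lambda>x. x * u + w) {x. f (x * u + w) = b} (f -` {b})"
    by (rule bij_betwI[of _ _ _ "\<lambda>x. (x - w) / u"]) (use assms in auto)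
qed

text \<open>For fixed \<open>y \<noteq> ystar\<close> the map in \<open>x\<close> is balanced and
  contributes \<open>M\<close>; for \<open>y = ystar\<close> it is constant with value
  \<open>\<rho> ystar\<close> and contributes all of the field or nothing.\<close>

lemma maiorana_mcfarland_counts:
  fixes L :: "'k::{field,finite} \<Rightarrow> 'b::{ab_group_add,finite}"
  assumes add: "\<And>x y. L (x + y) = L x + L y"
    and bal: "\<And>b. real (card (L -` {b})) = M"
    and "bij \<pi>" and ystar: "\<pi> ystar = 0"
  shows "real (card (maiorana_mcfarland L \<pi> \<rho> -` {b})) =
           real CARD('k) * M - M + real CARD('k) * of_bool (b = \<rho> ystar)"
    and "d \<noteq> 0 \<Longrightarrow> real (card {z. maiorana_mcfarland L \<pi> \<rho> (z + d) - maiorana_mcfarland L \<pi> \<rho> z = c})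
           = real CARD('k) * M"
proof -
  have L0: "L 0 = 0" using add[of 0 0] by simp
  have \<pi>_eq: "\<pi> y = \<pi> y' \<longleftrightarrow> y = y'" for y y'
    using \<open>bij \<pi>\<close> by (simp add: bij_is_inj inj_eq)
  have "maiorana_mcfarland L \<pi> \<rho> -` {b} = {(x, y). L (x * \<pi> y) + \<rho> y = b}"
    by (auto simp: maiorana_mcfarland_def)
  then have "real (card (maiorana_mcfarland L \<pi> \<rho> -` {b})) =
      (\<Sum>y\<in>UNIV. real (card {x. L (x * \<pi> y) + \<rho> y = b}))"
    by (simp add: card_fibrewise)
  also have "\<dots> = (\<Sum>y\<in>UNIV. M - (M - real CARD('k) * of_bool (b = \<rho> ystar)) * of_bool (y = ystar))"
  proof (intro sum.cong refl)
    fix y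
    show "real (card {x. L (x * \<pi> y) + \<rho> y = b}) =
        M - (M - real CARD('k) * of_bool (b = \<rho> ystar)) * of_bool (y = ystar)"
    proof (cases "y = ystar")
      case True
      then show ?thesis by (auto simp: ystar L0)
    next
      case False
      then have "\<pi> y \<noteq> 0" using \<pi>_eq[of y ystar] ystar by simp
      then have "card {x. L (x * \<pi> y + 0) = b - \<rho> y} = card (L -` {b - \<rho> y})"
        by (rule card_vimage_affine)
      then show ?thesis using bal False by (simp add: eq_diff_eq)
    qed
  qed
  also have "\<dots> = real CARD('k) * M - M + real CARD('k) * of_bool (b = \<rho> ystar)"
    by (simp add: sum_subtractf flip: sum_distrib_left)
  finally show "real (card (maiorana_mcfarland L \<pi> \<rho> -` {b})) =
      real CARD('k) * M - M + real CARD('k) * of_bool (b = \<rho> ystar)" .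
  assume d: "d \<noteq> 0"
  obtain a e where ae: "d = (a, e)" by (cases d)
  let ?D = "{z. maiorana_mcfarland L \<pi> \<rho> (z + d) - maiorana_mcfarland L \<pi> \<rho> z = c}"
  \<comment> \<open>Splitting off \<open>L (x * \<pi> y)\<close> shows that the derivative, for
    fixed \<open>y\<close>, is up to a constant \<open>L\<close> of an affine map in
    \<open>x\<close> with slope \<open>\<pi> (y + e) - \<pi> y\<close>.\<close>
  have "L ((x + a) * \<pi> (y + e)) = L (x * (\<pi> (y + e) - \<pi> y) + a * \<pi> (y + e)) + L (x * \<pi> y)" for x y
    by (simp add: algebra_simps flip: add)
  then have D: "?D =
      {(x, y). L (x * (\<pi> (y + e) - \<pi> y) + a * \<pi> (y + e)) = c - \<rho> (y + e) + \<rho> y}"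
    by (auto simp: maiorana_mcfarland_def ae algebra_simps)
  have card_D: "card ?D =
      (\<Sum>y\<in>UNIV. card {x. L (x * (\<pi> (y + e) - \<pi> y) + a * \<pi> (y + e)) = c - \<rho> (y + e) + \<rho> y})"
    unfolding D by (rule card_fibrewise)
  show "real (card ?D) = real CARD('k) * M"
  proof (cases "e = 0")
    case False
    \<comment> \<open>Injectivity of \<open>\<pi>\<close> keeps the slope nonzero, so every fibre
      contributes \<open>M\<close>.\<close>
    then have "\<pi> (y + e) - \<pi> y \<noteq> 0" for y
      by (simp add: \<pi>_eq)
    then show ?thesis
      unfolding card_D by (simp add: card_vimage_affine bal)
  next
    case True
    then have a: "a \<noteq> 0" using d ae by (auto simp: zero_prod_def)
    \<comment> \<open>The slope vanishes, so the condition is independent of \<open>x\<close> and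
      each \<open>y\<close> contributes all or nothing. Since \<open>y\<close> enters through the
      permutation \<open>a * \<pi> y\<close>, exactly \<open>M\<close> values of \<open>y\<close>
      qualify.\<close>
    have "card ?D = (\<Sum>y\<in>UNIV. real CARD('k) * of_bool (L (a * \<pi> y) = c))"
      unfolding card_D of_nat_sum using True by (intro sum.cong refl) auto
    also have "\<dots> = CARD('k) * card {y. L (a * \<pi> y) = c}"
      by (simp flip: sum_distrib_left)
    also have "card {y. L (a * \<pi> y) = c} = card {x. L (x * a + 0) = c}"
    proof (rule bij_betw_same_card[of \<pi>], rule bij_betw_subset[OF \<open>bij \<pi>\<close> subset_UNIV])
      show "\<pi> ` {y. L (a * \<pi> y) = c} = {x. L (x * a + 0) = c}"
        using surj_image_vimage_eq[OF bij_is_surj[OF \<open>bij \<pi>\<close>], of "{x. L (x * a + 0) = c}"]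
        by (simp add: vimage_def mult.commute)
    qed
    also have "\<dots> = card (L -` {c})"
      using a by (rule card_vimage_affine)
    finally show ?thesis by (simp add: bal)
  qed
qed

section \<open>Both families over the prime field\<close>

theorem proposition3p2:
  fixes p n m :: nat
  assumes "prime p" and "even n"
    and "CARD('p::prime_card) = p"
    and "CARD('m::finite) = m"
    and "CARD('k::{field,finite}) = p ^ (n div 2)"
  shows
    "(\<forall>(F :: 'k \<times> 'k \<Rightarrow> 'p mod_ring ^ 'm) (L :: 'k \<Rightarrow> 'p mod_ring ^ 'm)
        (\<pi> :: 'k \<Rightarrow> 'k) (\<rho> :: 'k \<Rightarrow> 'p mod_ring ^ 'm) (ystar :: 'k) (\<alpha> :: 'p mod_ring ^ 'm).
        F = maiorana_mcfarland L \<pi> \<rho> \<and> bij \<pi> \<and>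
        Vector_Spaces.linear fp_scale (*s) L \<and> surj L \<and>
        \<pi> ystar = 0 \<and> \<alpha> = \<rho> ystar \<longrightarrow>
          real (card (F -` {\<alpha>})) =
            real p powi (int n - int m) + real p powi int (n div 2)
              - real p powi (int (n div 2) - int m) \<and>
          (\<forall>\<beta>. \<beta> \<noteq> \<alpha> \<longrightarrow>
            real (card (F -` {\<beta>})) =
              real p powi (int n - int m) - real p powi (int (n div 2) - int m)) \<and>
          almost_balanced_plus p n m F) \<and>
     (\<forall>(F :: 'k \<times> 'k \<Rightarrow> 'p mod_ring ^ 'm) (\<Psi> :: 'k \<Rightarrow> 'p mod_ring ^ 'm).
        F = desarguesian_ps \<Psi> \<and> balanced p (n div 2) m \<Psi> \<longrightarrow>
          real (card (F -` {\<Psi> 0})) =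
            real p powi (int n - int m) + real p powi int (n div 2)
              - real p powi (int (n div 2) - int m) \<and>
          (\<forall>\<beta>. \<beta> \<noteq> \<Psi> 0 \<longrightarrow>
            real (card (F -` {\<beta>})) =
              real p powi (int n - int m) - real p powi (int (n div 2) - int m)) \<and>
          almost_balanced_plus p n m F)"
proof -
  define q M where "q = real p powi int (n div 2)" and "M = real p powi (int (n div 2) - int m)"
  have p0: "real p \<noteq> 0" using \<open>prime p\<close> by auto
  have card_k: "real CARD('k) = q"
    using assms(5) by (simp add: q_def)
  \<comment> \<open>Evenness of \<open>n\<close> splits the exponent as
    \<open>n - m = n/2 + (n/2 - m)\<close>.\<close>
  have qM: "real p powi (int n - int m) = q * M"
  proof -
    have "int n - int m = int (n div 2) + (int (n div 2) - int m)"
      using \<open>even n\<close> by auto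
    then show ?thesis
      unfolding q_def M_def using power_int_add[of "real p"] p0 by metis
  qed
  \<comment> \<open>Both families have counts of this shape, with exceptional value
    \<open>\<rho> ystar\<close> or \<open>\<Psi> 0\<close>.\<close>
  have main: "real (card (F -` {\<alpha>})) =
            real p powi (int n - int m) + real p powi int (n div 2)
              - real p powi (int (n div 2) - int m) \<and>
          (\<forall>\<beta>. \<beta> \<noteq> \<alpha> \<longrightarrow>
            real (card (F -` {\<beta>})) =
              real p powi (int n - int m) - real p powi (int (n div 2) - int m)) \<and>
          almost_balanced_plus p n m F"
    if "\<And>b. real (card (F -` {b})) = real CARD('k) * M - M + real CARD('k) * of_bool (b = \<alpha>)"
      and "\<And>d c. d \<noteq> 0 \<Longrightarrow> real (card {z. F (z + d) - F z = c}) = real CARD('k) * M"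
    for F :: "'k \<times> 'k \<Rightarrow> 'p mod_ring ^ 'm" and \<alpha>
    unfolding almost_balanced_plus_def bent_def qM q_def[symmetric] M_def[symmetric]
    using that unfolding card_k by auto
  show ?thesis
  proof (intro conjI[of "\<forall>F. _ F"] allI impI; elim conjE)
    fix F :: "'k \<times> 'k \<Rightarrow> 'p mod_ring ^ 'm" and L \<pi> \<rho> ystar \<alpha>
    assume F: "F = maiorana_mcfarland L \<pi> \<rho>" and \<pi>: "bij \<pi>" "\<pi> ystar = 0"
      and L: "Vector_Spaces.linear fp_scale (*s) L" "surj L" and \<alpha>: "\<alpha> = \<rho> ystar"
    have add: "L (x + y) = L x + L y" for x y
      using L(1) by (simp add: linear_iff_module_hom module_hom.add)
    have "real (card (L -` {b})) = M" for b
    proof -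
      \<comment> \<open>The codomain has order \<open>p ^ m\<close>, so each fibre of
        \<open>L\<close> has size \<open>q / p ^ m\<close>.\<close>
      have "real (card (L -` {b})) * real p ^ m = q"
        using card_vimage_additive[OF add L(2), of b] assms(3,4) card_k
        by (simp add: CARD_vec flip: of_nat_power of_nat_mult)
      then show ?thesis
        using p0 by (simp add: q_def M_def power_int_diff field_simps)
    qed
    from maiorana_mcfarland_counts[OF add this \<pi>]
    show "real (card (F -` {\<alpha>})) =
            real p powi (int n - int m) + real p powi int (n div 2)
              - real p powi (int (n div 2) - int m) \<and>
          (\<forall>\<beta>. \<beta> \<noteq> \<alpha> \<longrightarrow>
            real (card (F -` {\<beta>})) =
              real p powi (int n - int m) - real p powi (int (n div 2) - int m)) \<and>
          almost_balanced_plus p n m F"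
      unfolding F \<alpha> by (rule main)
  next
    fix F :: "'k \<times> 'k \<Rightarrow> 'p mod_ring ^ 'm" and \<Psi>
    assume F: "F = desarguesian_ps \<Psi>" and "balanced p (n div 2) m \<Psi>"
    then have "real (card (\<Psi> -` {b})) = M" for b
      by (simp add: balanced_def M_def)
    from desarguesian_ps_counts[OF this]
    show "real (card (F -` {\<Psi> 0})) =
            real p powi (int n - int m) + real p powi int (n div 2)
              - real p powi (int (n div 2) - int m) \<and>
          (\<forall>\<beta>. \<beta> \<noteq> \<Psi> 0 \<longrightarrow>
            real (card (F -` {\<beta>})) =
              real p powi (int n - int m) - real p powi (int (n div 2) - int m)) \<and>
          almost_balanced_plus p n m F"
      unfolding F by (rule main)
  qed
qed

end
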